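(* Let $0<\theta<1$ and let $\phi_1,\dots,\phi_N$ be finite Blaschke products with $\phi_j(0)=0$ for all $1\le j\le N$. (1) If $\phi_j'(0)=0$ for all $1\le j\le N$, then there exist $\beta,\gamma>0$ and $C>0$ such that for any $a\in\mathbb{F}_N^+$ $$\|\mathcal{L}^a\|_{\mathcal{H}^0_{\theta^{-1}}\to\mathcal{H}^0_{\theta^{-1}}}\le Ce^{-\beta e^{\gamma|a|}}.$$ (2) If $|\phi_j'(0)|<1$ for all $1\le j\le N$, then there exist $\kappa>0$ and $C>0$ such that for any $a\in\mathbb{F}_N^+$ $$\|\mathcal{L}^a\|_{\mathcal{H}^0_{\theta^{-1}}\to\mathcal{H}^0_{\theta^{-1}}}\le Ce^{-\kappa|a|}.$$
   Context: $\mathbb{S}^1=\{|z|=1\}$. A finite Blaschke product is a map $\phi(z)=e^{i\psi}\prod_{i=1}^q\frac{z-\lambda_i}{1-\overline{\lambda_i}z}$ with $\psi\in[0,2\pi)$, $|\lambda_i|<1$, $q\ge1$. For $0<\theta<1$ the space of hyperfunctions $\mathcal{H}_{\theta^{-1}}$ is the closure (completion) of the linear combinations of $z^k$, $k\in\mathbb{Z}$, with respect to $\|f\|_{\theta^{-1}}=\sqrt{\sum_{k\in\mathbb{Z}}|f_k|^2\theta^{2|k|}}$, where $f_k$ are the Fourier coefficients of $f$; $\mathcal{H}^0_{\theta^{-1}}$ is the subspace of those $f$ with $f_0=0$. $\mathbb{F}_N^+$ is the free semigroup of words $a=i_1i_2\dots i_n$ in the letters $1,\dots,N$, with length $|a|=n$,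 and $\tau(a)=\phi_{i_n}\circ\dots\circ\phi_{i_1}$. $\mathcal{L}^a$ is the Koopman operator $\mathcal{L}^af=f\circ\tau(a)$, defined on trigonometric polynomials and extended by continuity to $\mathcal{H}^0_{\theta^{-1}}$. *)

theory Defs
  imports "HOL-Analysis.Analysis"
begin

text \<open>The formula is required only on the closed disc: outside it the quotients have poles,
  where division by zero would prescribe meaningless values.\<close>

definition finite_blaschke :: "(complex \<Rightarrow> complex) \<Rightarrow> bool" where
  "finite_blaschke \<phi> \<longleftrightarrow>
     (\<exists>(\<psi>::real) (q::nat) (l::nat \<Rightarrow> complex).
        0 \<le> \<psi> \<and> \<psi> < 2 * pi \<and> q \<ge> 1 \<and> (\<forall>i\<in>{1..q}. cmod (l i) < 1) \<and>
        (\<forall>z. cmod z \<le> 1 \<longrightarrow>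
           \<phi> z = exp (\<i> * complex_of_real \<psi>) * (\<Prod>i=1..q. (z - l i) / (1 - cnj (l i) * z))))"

text \<open>A hyperfunction is represented by its family of Fourier coefficients, and a trigonometric
  polynomial by a finitely supported family.  The sum in \<open>hyp_norm\<close> is \<open>0\<close> when it diverges, so
  \<open>hyp_norm\<close> is meaningful on \<open>hyp_space\<close> only.  That \<open>hyp_space\<close> is the completion of the
  trigonometric polynomials is the content of \<open>Metric_space_hyp_space\<close>, \<open>mcomplete_hyp_space\<close>
  and \<open>closure_trig_polys\<close>.\<close>

definition hyp_norm :: "real \<Rightarrow> (int \<Rightarrow> complex) \<Rightarrow> real" where
  "hyp_norm \<theta> f = sqrt (\<Sum>\<^sub>\<infinity>k\<in>UNIV. (cmod (f k))\<^sup>2 * \<theta> ^ (2 * nat \<bar>k\<bar>))"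

definition hyp_space :: "real \<Rightarrow> (int \<Rightarrow> complex) set" where
  "hyp_space \<theta> = {f. (\<lambda>k. (cmod (f k))\<^sup>2 * \<theta> ^ (2 * nat \<bar>k\<bar>)) summable_on UNIV}"

definition hyp_space0 :: "real \<Rightarrow> (int \<Rightarrow> complex) set" where
  "hyp_space0 \<theta> = {f \<in> hyp_space \<theta>. f 0 = 0}"

definition hyp_dist :: "real \<Rightarrow> (int \<Rightarrow> complex) \<Rightarrow> (int \<Rightarrow> complex) \<Rightarrow> real" where
  "hyp_dist \<theta> f g = hyp_norm \<theta> (\<lambda>k. f k - g k)"

definition trig_polys :: "(int \<Rightarrow> complex) set" where
  "trig_polys = {f. finite {k. f k \<noteq> 0}}"

definition trig_eval :: "(int \<Rightarrow> complex) \<Rightarrow> complex \<Rightarrow> complex" where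
  "trig_eval f z = (\<Sum>k | f k \<noteq> 0. f k * z powi k)"

definition fourier_coeff :: "(complex \<Rightarrow> complex) \<Rightarrow> int \<Rightarrow> complex" where
  "fourier_coeff g k =
     integral {0..2*pi} (\<lambda>t. g (cis t) * cis (- (of_int k * t))) / complex_of_real (2 * pi)"

definition hyp_topology0 :: "real \<Rightarrow> (int \<Rightarrow> complex) topology" where
  "hyp_topology0 \<theta> = Metric_space.mtopology (hyp_space0 \<theta>) (hyp_dist \<theta>)"

text \<open>The Koopman operator of \<open>T\<close> is the unique continuous self-map of \<open>hyp_space0 \<theta>\<close> that sends
  a trigonometric polynomial \<open>p\<close> without constant term to \<open>p \<circ> T\<close>; requiring it to be extensional
  fixes its value outside its domain.\<close>

definition koopman ::
    "real \<Rightarrow> (complex \<Rightarrow> complex) \<Rightarrow> (int \<Rightarrow> complex) \<Rightarrow> (int \<Rightarrow> complex)" where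
  "koopman \<theta> T =
     (THE L. L \<in> extensional (hyp_space0 \<theta>) \<and>
             continuous_map (hyp_topology0 \<theta>) (hyp_topology0 \<theta>) L \<and>
             (\<forall>p \<in> trig_polys \<inter> hyp_space0 \<theta>. L p = fourier_coeff (trig_eval p \<circ> T)))"

text \<open>The value is \<open>\<infinity>\<close> if \<open>L\<close> does not map \<open>hyp_space0 \<theta>\<close> to itself or is unbounded.\<close>

definition hyp_opnorm0 :: "real \<Rightarrow> ((int \<Rightarrow> complex) \<Rightarrow> (int \<Rightarrow> complex)) \<Rightarrow> ennreal" where
  "hyp_opnorm0 \<theta> L =
     Inf {ennreal M | M. 0 \<le> M \<and>
            (\<forall>f\<in>hyp_space0 \<theta>. L f \<in> hyp_space0 \<theta> \<and> hyp_norm \<theta> (L f) \<le> M * hyp_norm \<theta> f)}"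

text \<open>For the word \<open>a = [i\<^sub>1, \<dots>, i\<^sub>n]\<close> this is \<open>\<phi> i\<^sub>n \<circ> \<dots> \<circ> \<phi> i\<^sub>1\<close>.\<close>

definition word_map :: "(nat \<Rightarrow> complex \<Rightarrow> complex) \<Rightarrow> nat list \<Rightarrow> complex \<Rightarrow> complex" where
  "word_map \<phi> a = fold \<phi> a"

definition words :: "nat \<Rightarrow> nat list set" where
  "words N = {a. set a \<subseteq> {1..N}}"


lemma trig_polys_subset: "trig_polys \<subseteq> hyp_space \<theta>"
proof
  fix f assume "f \<in> trig_polys"
  then have "finite {k. f k \<noteq> 0}" by (simp add: trig_polys_def)
  then have "(\<lambda>k. (cmod (f k))\<^sup>2 * \<theta> ^ (2 * nat \<bar>k\<bar>)) summable_on {k. f k \<noteq> 0}" by simp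
  then show "f \<in> hyp_space \<theta>"
    unfolding hyp_space_def mem_Collect_eq
    by (rule summable_on_cong_neutral[THEN iffD1, rotated -1]) auto
qed

lemma fourier_coeff_trig_eval:
  assumes "f \<in> trig_polys"
  shows "fourier_coeff (trig_eval f) = f"
proof
  fix k
  let ?S = "{j. f j \<noteq> 0}"
  have fin: "finite ?S" using assms by (simp add: trig_polys_def)
  have 1: "((\<lambda>t. cis (of_int m * t)) has_integral (if m = 0 then complex_of_real (2*pi) else 0)) {0..2*pi}"
    for m :: int
  proof (cases "m = 0")
    case True
    then show ?thesis using has_integral_const_real[of "1::complex" 0 "2*pi"]
      by (simp add: scaleR_conv_of_real)
  next
    case False
    have "((\<lambda>t. cis (of_int m * t)) has_integral
        (cis (of_int m * (2*pi)) / (\<i> * of_int m) - cis (of_int m * 0) / (\<i> * of_int m))) {0..2*pi}"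
    proof (rule fundamental_theorem_of_calculus)
      fix t :: real
      have "((\<lambda>z. exp (\<i> * of_int m * z) / (\<i> * of_int m)) has_field_derivative
               exp (\<i> * of_int m * of_real t)) (at (of_real t))"
        using False by (auto intro!: derivative_eq_intros)
      from has_vector_derivative_real_field[OF this]
      show "((\<lambda>t. cis (of_int m * t) / (\<i> * of_int m)) has_vector_derivative cis (of_int m * t))
          (at t within {0..2*pi})"
        by (simp add: cis_conv_exp mult_ac has_vector_derivative_at_within)
    qed simp
    moreover have "cis (of_int m * (2*pi)) = 1"
      using cis_multiple_2pi[of "of_int m"] by (simp add: mult_ac)
    ultimately show ?thesis using False by simp
  qed
  have "((\<lambda>t. \<Sum>j\<in>?S. f j * cis (of_int (j - k) * t)) has_integral
      (\<Sum>j\<in>?S. f j * (if j - k = 0 then complex_of_real (2*pi) else 0))) {0..2*pi}"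
    by (intro has_integral_sum fin has_integral_mult_right 1)
  moreover have "(\<Sum>j\<in>?S. f j * (if j - k = 0 then complex_of_real (2*pi) else 0))
      = f k * complex_of_real (2*pi)"
    using fin by (simp add: if_distrib sum.delta cong: if_cong)
  moreover have "(\<lambda>t. \<Sum>j\<in>?S. f j * cis (of_int (j - k) * t))
     = (\<lambda>t. trig_eval f (cis t) * cis (- (of_int k * t)))"
  proof
    fix t
    have "cis (of_int (j - k) * t) = cis t powi j * cis (- (of_int k * t))" for j
      by (simp add: cis_power_int cis_mult left_diff_distrib)
    then show "(\<Sum>j\<in>?S. f j * cis (of_int (j - k) * t)) = trig_eval f (cis t) * cis (- (of_int k * t))"
      by (simp only: trig_eval_def sum_distrib_right mult.assoc)
  qed
  ultimately show "fourier_coeff (trig_eval f) k = f k"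
    unfolding fourier_coeff_def by (simp add: integral_unique)
qed

context
  fixes \<theta> :: real
  assumes \<theta>: "0 < \<theta>"
begin

private abbreviation W :: "(int \<Rightarrow> complex) \<Rightarrow> int \<Rightarrow> real" where
  "W f k \<equiv> cmod (f k) * \<theta> ^ nat \<bar>k\<bar>"

lemma hyp_space_W: "f \<in> hyp_space \<theta> \<longleftrightarrow> (\<lambda>k. (W f k)\<^sup>2) summable_on UNIV"
  and hyp_norm_W: "hyp_norm \<theta> f = sqrt (\<Sum>\<^sub>\<infinity>k\<in>UNIV. (W f k)\<^sup>2)"
  by (simp_all add: hyp_space_def hyp_norm_def power_mult_distrib power_even_eq)

lemma hyp_norm_nonneg: "0 \<le> hyp_norm \<theta> f"
  by (simp add: hyp_norm_W infsum_nonneg)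

lemma L2_set_le_hyp_norm:
  assumes "f \<in> hyp_space \<theta>" "finite F"
  shows "L2_set (W f) F \<le> hyp_norm \<theta> f"
  unfolding L2_set_def hyp_norm_W
  using assms by (auto simp: hyp_space_W intro!: finite_sum_le_infsum)

lemma hyp_space_bound:
  assumes "\<And>F. finite F \<Longrightarrow> L2_set (W f) F \<le> B"
  shows "f \<in> hyp_space \<theta>" "hyp_norm \<theta> f \<le> B"
proof -
  have B: "B \<ge> 0" using assms[of "{}"] by simp
  have le: "sum (\<lambda>k. (W f k)\<^sup>2) F \<le> B\<^sup>2" if "finite F" for F
  proof -
    have "sqrt (sum (\<lambda>k. (W f k)\<^sup>2) F) \<le> B"
      using assms[OF that] by (simp add: L2_set_def)
    then show ?thesis by (simp add: real_sqrt_le_iff sqrt_le_D)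
  qed
  show *: "f \<in> hyp_space \<theta>"
    unfolding hyp_space_W
  proof (rule nonneg_bdd_above_summable_on)
    show "bdd_above (sum (\<lambda>k. (W f k)\<^sup>2) ` {F. F \<subseteq> UNIV \<and> finite F})"
      using le by (intro bdd_aboveI2[where M = "B\<^sup>2"]) blast
  qed simp
  have "(\<Sum>\<^sub>\<infinity>k\<in>UNIV. (W f k)\<^sup>2) \<le> B\<^sup>2"
    by (rule infsum_le_finite_sums) (use * le in \<open>simp_all only: hyp_space_W\<close>)
  then show "hyp_norm \<theta> f \<le> B"
    using B by (simp add: hyp_norm_W real_le_lsqrt infsum_nonneg)
qed

lemma W_triangle: "L2_set (W (\<lambda>k. f k + g k)) F \<le> L2_set (W f) F + L2_set (W g) F"
proof -
  have "L2_set (W (\<lambda>k. f k + g k)) F \<le> L2_set (\<lambda>k. W f k + W g k) F"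
  proof (rule L2_set_mono)
    fix k
    show "W (\<lambda>k. f k + g k) k \<le> W f k + W g k"
      using mult_right_mono[OF norm_triangle_ineq[of "f k" "g k"], of "\<theta> ^ nat \<bar>k\<bar>"] \<theta>
      by (simp add: distrib_right)
    show "0 \<le> W (\<lambda>k. f k + g k) k" using \<theta> by simp
  qed
  also have "\<dots> \<le> L2_set (W f) F + L2_set (W g) F" by (rule L2_set_triangle_ineq)
  finally show ?thesis .
qed

lemma hyp_add:
  assumes "f \<in> hyp_space \<theta>" "g \<in> hyp_space \<theta>"
  shows "(\<lambda>k. f k + g k) \<in> hyp_space \<theta>"
    "hyp_norm \<theta> (\<lambda>k. f k + g k) \<le> hyp_norm \<theta> f + hyp_norm \<theta> g"
proof -
  have "L2_set (W (\<lambda>k. f k + g k)) F \<le> hyp_norm \<theta> f + hyp_norm \<theta> g" if "finite F" for F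
    using W_triangle[of f g F] L2_set_le_hyp_norm[OF assms(1) that] L2_set_le_hyp_norm[OF assms(2) that]
    by linarith
  from hyp_space_bound[OF this]
  show "(\<lambda>k. f k + g k) \<in> hyp_space \<theta>"
    "hyp_norm \<theta> (\<lambda>k. f k + g k) \<le> hyp_norm \<theta> f + hyp_norm \<theta> g" by blast+
qed

lemma hyp_uminus: "f \<in> hyp_space \<theta> \<Longrightarrow> (\<lambda>k. - f k) \<in> hyp_space \<theta>"
  by (simp add: hyp_space_def)

lemma hyp_diff:
  assumes "f \<in> hyp_space \<theta>" "g \<in> hyp_space \<theta>"
  shows "(\<lambda>k. f k - g k) \<in> hyp_space \<theta>"
  using hyp_add(1)[OF assms(1) hyp_uminus[OF assms(2)]] by simp

lemma coeff_le_hyp_norm: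
  assumes "f \<in> hyp_space \<theta>"
  shows "W f k \<le> hyp_norm \<theta> f"
  using L2_set_le_hyp_norm[OF assms, of "{k}"] by (simp add: L2_set_def)

lemma Metric_space_hyp_space: "Metric_space (hyp_space \<theta>) (hyp_dist \<theta>)"
proof
  show "0 \<le> hyp_dist \<theta> f g" for f g by (simp add: hyp_dist_def hyp_norm_nonneg)
  show "hyp_dist \<theta> f g = hyp_dist \<theta> g f" for f g
    by (simp add: hyp_dist_def hyp_norm_def norm_minus_commute)
  show "(hyp_dist \<theta> f g = 0) = (f = g)" if "f \<in> hyp_space \<theta>" "g \<in> hyp_space \<theta>" for f g
  proof
    assume "hyp_dist \<theta> f g = 0"
    then have "W (\<lambda>k. f k - g k) k \<le> 0" for k
      using coeff_le_hyp_norm[OF hyp_diff[OF that], of k] by (simp add: hyp_dist_def)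
    then have "f k = g k" for k
      using \<theta> zero_less_power[OF \<theta>, of "nat \<bar>k\<bar>"]
      by (metis mult_le_0_iff norm_le_zero_iff eq_iff_diff_eq_0 not_le)
    then show "f = g" by blast
  qed (simp add: hyp_dist_def hyp_norm_def)
  show "hyp_dist \<theta> f h \<le> hyp_dist \<theta> f g + hyp_dist \<theta> g h"
    if "f \<in> hyp_space \<theta>" "g \<in> hyp_space \<theta>" "h \<in> hyp_space \<theta>" for f g h
    using hyp_add(2)[OF hyp_diff[OF that(1,2)] hyp_diff[OF that(2,3)]] by (simp add: hyp_dist_def)
qed

lemma mcomplete_hyp_space: "Metric_space.mcomplete (hyp_space \<theta>) (hyp_dist \<theta>)"
proof -
  interpret Metric_space "hyp_space \<theta>" "hyp_dist \<theta>" by (rule Metric_space_hyp_space)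
  show ?thesis
    unfolding mcomplete_def
  proof (intro allI impI)
    fix s assume s: "MCauchy s"
    then have sH: "s n \<in> hyp_space \<theta>" for n by (auto simp: MCauchy_def)
    have "convergent (\<lambda>n. s n k)" for k
    proof -
      have "Cauchy (\<lambda>n. s n k)"
        unfolding Cauchy_def
      proof (intro allI impI)
        fix e :: real assume "e > 0"
        then have "e * \<theta> ^ nat \<bar>k\<bar> > 0" using \<theta> by simp
        then obtain N where N: "\<And>n m. n \<ge> N \<Longrightarrow> m \<ge> N \<Longrightarrow> hyp_dist \<theta> (s n) (s m) < e * \<theta> ^ nat \<bar>k\<bar>"
          using s unfolding MCauchy_def by blast
        have "dist (s m k) (s n k) < e" if "m \<ge> N" "n \<ge> N" for m n
        proof -
          have "cmod (s m k - s n k) * \<theta> ^ nat \<bar>k\<bar> < e * \<theta> ^ nat \<bar>k\<bar>"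
            using coeff_le_hyp_norm[OF hyp_diff[OF sH[of m] sH[of n]], of k] N[OF that]
            by (simp add: hyp_dist_def)
          then show ?thesis using \<theta> by (simp add: dist_norm)
        qed
        then show "\<exists>M. \<forall>m\<ge>M. \<forall>n\<ge>M. dist (s m k) (s n k) < e" by blast
      qed
      then show ?thesis by (rule Cauchy_convergent)
    qed
    then have "\<forall>k. \<exists>l. (\<lambda>n. s n k) \<longlonglongrightarrow> l" unfolding convergent_def by blast
    from choice[OF this] obtain g where g: "\<And>k. (\<lambda>n. s n k) \<longlonglongrightarrow> g k" by blast
    have key: "\<exists>N. \<forall>n\<ge>N. (\<lambda>k. s n k - g k) \<in> hyp_space \<theta> \<and> hyp_norm \<theta> (\<lambda>k. s n k - g k) \<le> e"
      if e: "e > 0" for e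
    proof -
      obtain N where N: "\<And>n m. n \<ge> N \<Longrightarrow> m \<ge> N \<Longrightarrow> hyp_dist \<theta> (s n) (s m) < e"
        using s e unfolding MCauchy_def by blast
      have "L2_set (W (\<lambda>k. s n k - g k)) F \<le> e" if "n \<ge> N" "finite F" for n F
      proof (rule LIMSEQ_le_const2)
        show "(\<lambda>m. L2_set (W (\<lambda>k. s n k - s m k)) F) \<longlonglongrightarrow> L2_set (W (\<lambda>k. s n k - g k)) F"
          unfolding L2_set_def by (intro tendsto_intros g)
        show "\<exists>M. \<forall>m\<ge>M. L2_set (W (\<lambda>k. s n k - s m k)) F \<le> e"
        proof (intro exI allI impI)
          fix m assume "m \<ge> N"
          then show "L2_set (W (\<lambda>k. s n k - s m k)) F \<le> e"
            using L2_set_le_hyp_norm[OF hyp_diff[OF sH[of n] sH[of m]] that(2)] N[OF that(1), of m]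
            by (simp add: hyp_dist_def)
        qed
      qed
      from hyp_space_bound[OF this] show ?thesis by blast
    qed
    obtain N where "(\<lambda>k. s N k - g k) \<in> hyp_space \<theta>" using key[of 1] by auto
    from hyp_diff[OF sH this, of N] have gH: "g \<in> hyp_space \<theta>" by simp
    have "limitin mtopology s g sequentially"
      unfolding limitin_metric eventually_sequentially
    proof (intro conjI allI impI gH)
      fix e :: real assume "e > 0"
      then obtain N where N: "\<forall>n\<ge>N. hyp_dist \<theta> (s n) g \<le> e/2"
        using key[of "e/2"] unfolding hyp_dist_def by auto
      show "\<exists>N. \<forall>n\<ge>N. s n \<in> hyp_space \<theta> \<and> hyp_dist \<theta> (s n) g < e"
      proof (intro exI allI impI conjI sH)
        fix n assume "n \<ge> N"
        with N have "hyp_dist \<theta> (s n) g \<le> e/2" by blast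
        with \<open>e > 0\<close> show "hyp_dist \<theta> (s n) g < e" by linarith
      qed
    qed
    then show "\<exists>x. limitin mtopology s x sequentially" by blast
  qed
qed

lemma closure_trig_polys:
  "Metric_space.mtopology (hyp_space \<theta>) (hyp_dist \<theta>) closure_of trig_polys = hyp_space \<theta>"
proof -
  interpret Metric_space "hyp_space \<theta>" "hyp_dist \<theta>" by (rule Metric_space_hyp_space)
  have "\<exists>p\<in>trig_polys. hyp_dist \<theta> f p < e" if f: "f \<in> hyp_space \<theta>" and e: "e > 0" for f e
  proof -
    let ?w = "\<lambda>k. (W f k)\<^sup>2"
    have "(?w has_sum infsum ?w UNIV) UNIV" using f by (simp add: hyp_space_W)
    then have "\<forall>\<^sub>F G in finite_subsets_at_top UNIV. dist (sum ?w G) (infsum ?w UNIV) < (e/2)\<^sup>2"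
      unfolding has_sum_def by (rule tendstoD) (use e in simp)
    then have "\<exists>F. finite F \<and> (\<forall>G. finite G \<and> F \<subseteq> G \<longrightarrow>
        dist (sum ?w G) (infsum ?w UNIV) < (e/2)\<^sup>2)"
      unfolding eventually_finite_subsets_at_top by (simp only: subset_UNIV simp_thms)
    then obtain F where F: "finite F" and
      "\<forall>G. finite G \<and> F \<subseteq> G \<longrightarrow> dist (sum ?w G) (infsum ?w UNIV) < (e/2)\<^sup>2"
      by (elim exE conjE)
    then have *: "\<And>G. finite G \<Longrightarrow> F \<subseteq> G \<Longrightarrow> dist (sum ?w G) (infsum ?w UNIV) < (e/2)\<^sup>2"
      by simp
    define p where "p k = (if k \<in> F then f k else 0)" for k
    have p: "p \<in> trig_polys"
      unfolding trig_polys_def mem_Collect_eq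
      by (rule finite_subset[OF _ F]) (auto simp: p_def)
    have "L2_set (W (\<lambda>k. f k - p k)) G \<le> e/2" if G: "finite G" for G
    proof -
      have "sum (\<lambda>k. (W (\<lambda>k. f k - p k) k)\<^sup>2) G = sum ?w (G - F)"
        using G by (intro sum.mono_neutral_cong_right) (auto simp: p_def)
      also have "\<dots> = sum ?w (G \<union> F) - sum ?w F"
        using sum.union_disjoint[of "G - F" F ?w] G F by (simp add: Int_commute)
      also have "\<dots> \<le> infsum ?w UNIV - sum ?w F"
      proof (rule diff_right_mono)
        show "sum ?w (G \<union> F) \<le> infsum ?w UNIV"
          using G F f unfolding hyp_space_W by (intro finite_sum_le_infsum) simp_all
      qed
      also have "\<dots> \<le> (e/2)\<^sup>2"
        using *[OF F order_refl] unfolding dist_real_def by linarith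
      finally have "sqrt (sum (\<lambda>k. (W (\<lambda>k. f k - p k) k)\<^sup>2) G) \<le> sqrt ((e/2)\<^sup>2)"
        by (rule real_sqrt_le_mono)
      then show ?thesis using e by (simp only: L2_set_def real_sqrt_abs)
    qed
    from hyp_space_bound(2)[OF this] have "hyp_dist \<theta> f p \<le> e/2"
      unfolding hyp_dist_def by simp
    then have "hyp_dist \<theta> f p < e" using e by linarith
    with p show ?thesis by blast
  qed
  then show ?thesis
    unfolding metric_closure_of mball_def using trig_polys_subset[of \<theta>] by auto blast
qed

end

end

theory Submission
  imports Defs "HOL-Complex_Analysis.Conformal_Mappings"
begin

text \<open>
  A finite Blaschke product \<open>\<phi>\<close> with \<open>\<phi> 0 = 0\<close> is an inner function fixing the origin, and such
  functions are closed under composition; so \<open>\<tau>(a)\<close> is one for every word \<open>a\<close>.  For an inner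
  function \<open>T\<close> with \<open>T 0 = 0\<close> the matrix of \<open>f \<mapsto> f \<circ> T\<close> consists of the Fourier coefficients of
  \<open>T\<^sup>m\<close>, \<open>m \<noteq> 0\<close>.  For \<open>m > 0\<close> these are the Taylor coefficients of a holomorphic function, and
  negative powers reduce to positive ones because \<open>1/T\<close> is the conjugate of \<open>T\<close> on the unit
  circle.  If \<open>\<bar>T\<bar> \<le> \<rho>\<close> on the disc of radius \<open>r < 1\<close>, Cauchy's estimate bounds the entry \<open>(m, k)\<close>
  by \<open>\<rho>\<^sup>|\<^sup>m\<^sup>| / r\<^sup>|\<^sup>k\<^sup>|\<close> (\<open>fourier_coeff_inner_power\<close>).  When \<open>\<rho> < \<theta> < r\<close>, both factors are square
  summable against the weights, so by the Cauchy-Schwarz inequality the operator is bounded with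
  norm at most a constant times \<open>\<rho>/\<theta>\<close>, as long as \<open>\<rho>/\<theta>\<close> stays away from \<open>1\<close>
  (\<open>hyp_opnorm0_koopman_le\<close>).  Excluding constants is what gives
  the factor \<open>\<rho>/\<theta>\<close>: entries with \<open>m = 0\<close> carry no power of \<open>\<rho>\<close>.

  It remains to see how fast \<open>\<tau>(a)\<close> shrinks a disc of radius \<open>r\<close> slightly larger than \<open>\<theta>\<close>, and this is
  the Schwarz lemma.  If \<open>\<bar>\<phi>\<^sub>j'(0)\<bar> < 1\<close>, then \<open>\<phi>\<^sub>j(z)/z\<close> has modulus less than \<open>1\<close>, hence at most some \<open>c < 1\<close> on
  a compact disc, and \<open>\<rho> = c\<^sup>n r\<close> for words of length \<open>n\<close>.  If \<open>\<phi>\<^sub>j'(0) = 0\<close>, then \<open>\<phi>\<^sub>j(z)/z\<close> vanishes at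
  \<open>0\<close>, so the Schwarz lemma applies once more and gives \<open>\<bar>\<phi>\<^sub>j(z)\<bar> \<le> \<bar>z\<bar>\<^sup>2\<close>; iterating squares the
  radius at each letter, and \<open>\<rho>\<close> is \<open>r\<close> to the power \<open>2\<^sup>n\<close>.  The radius \<open>r\<close> is taken so close to
  \<open>\<theta>\<close> that \<open>\<rho> < \<theta>\<close> already for words of one letter; the empty word is the identity, of norm at most \<open>1\<close>.
\<close>

section \<open>Operators given by exponentially decaying matrices\<close>

text \<open>This is the \<open>\<ell>\<^sup>2\<close> norm of the family \<open>(x\<^sup>|\<^sup>m\<^sup>|)\<close> over the nonzero integers \<open>m\<close>, for \<open>0 \<le> x < 1\<close>.\<close>

definition geom_l2 :: "real \<Rightarrow> real" where
  "geom_l2 x = x * sqrt (2 / (1 - x\<^sup>2))"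

lemma geom_l2_nonneg: "0 \<le> x \<Longrightarrow> x < 1 \<Longrightarrow> 0 \<le> geom_l2 x"
  unfolding geom_l2_def by (simp add: abs_square_le_1 power_le_one)

text \<open>As long as \<open>x\<close> stays away from \<open>1\<close>, the norm \<open>geom_l2 x\<close> is linearly small in \<open>x\<close>; this
  linear factor is the source of the decay in the length of the word.\<close>

lemma geom_l2_le:
  assumes "0 \<le> x" "x \<le> y" "y < 1"
  shows "geom_l2 x \<le> x * sqrt (2 / (1 - y\<^sup>2))"
proof -
  have "y\<^sup>2 < 1" using assms by (simp add: power_less_one_iff abs_square_less_1)
  moreover have "x\<^sup>2 \<le> y\<^sup>2" using assms by (simp add: power_mono)
  ultimately have "2 / (1 - x\<^sup>2) \<le> 2 / (1 - y\<^sup>2)" by (intro divide_left_mono mult_pos_pos) auto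
  then show ?thesis
    unfolding geom_l2_def using assms by (intro mult_left_mono real_sqrt_le_mono)
qed

lemma sum_positive_powers_le:
  fixes y :: real
  assumes "0 \<le> y" "y < 1" "finite B" "0 \<notin> B"
  shows "(\<Sum>j\<in>B. y ^ j) \<le> y / (1 - y)"
proof -
  have "(\<Sum>j\<in>insert 0 B. y ^ j) \<le> (\<Sum>j. y ^ j)"
    using assms by (intro sum_le_suminf summable_geometric) auto
  also have "\<dots> = 1 / (1 - y)" using assms by (intro suminf_geometric) auto
  finally have "(\<Sum>j\<in>B. y ^ j) \<le> 1 / (1 - y) - 1" using assms by simp
  also have "\<dots> = y / (1 - y)" using assms by (simp add: field_simps)
  finally show ?thesis .
qed

text \<open>The positive and the negative indices each contribute a geometric series in \<open>x\<^sup>2\<close>.\<close>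

lemma L2_set_geometric_le:
  assumes "0 \<le> x" "x < 1" "finite F" "0 \<notin> F"
  shows "L2_set (\<lambda>m::int. x ^ nat \<bar>m\<bar>) F \<le> geom_l2 x"
proof -
  let ?y = "x\<^sup>2" and ?P = "{m\<in>F. 0 < m}" and ?N = "{m\<in>F. m < 0}"
  have y: "0 \<le> ?y" "?y < 1" using assms by (simp_all add: abs_square_less_1)
  have sq: "(x ^ nat \<bar>m\<bar>)\<^sup>2 = ?y ^ nat \<bar>m\<bar>" for m :: int by (simp add: power_mult[symmetric] mult.commute)
  have half: "(\<Sum>m\<in>S. ?y ^ nat \<bar>m\<bar>) \<le> ?y / (1 - ?y)"
    if "S \<subseteq> F" "inj_on (\<lambda>m. nat \<bar>m\<bar>) S" for S :: "int set"
  proof -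
    have "(\<Sum>m\<in>S. ?y ^ nat \<bar>m\<bar>) = (\<Sum>j\<in>(\<lambda>m. nat \<bar>m\<bar>) ` S. ?y ^ j)"
      by (simp add: sum.reindex[OF that(2)])
    also have "\<dots> \<le> ?y / (1 - ?y)"
      using that assms finite_subset by (intro sum_positive_powers_le y) auto
    finally show ?thesis .
  qed
  have F: "F = ?P \<union> ?N" using assms(4) by (auto, metis linorder_neqE_linordered_idom)
  have "(\<Sum>m\<in>F. ?y ^ nat \<bar>m\<bar>) = (\<Sum>m\<in>?P. ?y ^ nat \<bar>m\<bar>) + (\<Sum>m\<in>?N. ?y ^ nat \<bar>m\<bar>)"
    using assms(3) by (subst F, subst sum.union_disjoint) auto
  also have "\<dots> \<le> ?y / (1 - ?y) + ?y / (1 - ?y)"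
    by (intro add_mono half) (auto simp: inj_on_def)
  finally have "L2_set (\<lambda>m::int. x ^ nat \<bar>m\<bar>) F \<le> sqrt (?y * (2 / (1 - ?y)))"
    unfolding L2_set_def sq by (simp add: mult.commute)
  also have "\<dots> = geom_l2 x" unfolding geom_l2_def real_sqrt_mult using assms by simp
  finally show ?thesis .
qed

text \<open>The index \<open>m\<close> is the input frequency and \<open>k\<close> the output frequency, so \<open>A m\<close> is the image of the
  \<open>m\<close>-th monomial.\<close>

definition matrix_op :: "real \<Rightarrow> (int \<Rightarrow> int \<Rightarrow> complex) \<Rightarrow> (int \<Rightarrow> complex) \<Rightarrow> int \<Rightarrow> complex" where
  "matrix_op \<theta> A = restrict (\<lambda>f k. \<Sum>\<^sub>\<infinity>m. f m * A m k) (hyp_space0 \<theta>)"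

text \<open>The entries decay in the input frequency faster than the weight \<open>\<theta>\<^sup>|\<^sup>m\<^sup>|\<close> and in the output
  frequency like \<open>r\<^sup>-\<^sup>|\<^sup>k\<^sup>|\<close>, which is square summable against \<open>\<theta>\<^sup>|\<^sup>k\<^sup>|\<close> as \<open>\<theta> < r\<close>; this makes the operator Hilbert-Schmidt for the weighted norm.\<close>

locale decaying_matrix =
  fixes \<theta> r \<rho> :: real and A :: "int \<Rightarrow> int \<Rightarrow> complex"
  assumes \<theta>: "0 < \<theta>" and r: "\<theta> < r" and \<rho>: "0 \<le> \<rho>" "\<rho> < \<theta>"
    and decay: "\<And>m k. m \<noteq> 0 \<Longrightarrow> cmod (A m k) \<le> \<rho> ^ nat \<bar>m\<bar> / r ^ nat \<bar>k\<bar>"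
    and mean_zero: "\<And>m. m \<noteq> 0 \<Longrightarrow> A m 0 = 0"
begin

text \<open>The Cauchy-Schwarz inequality in the input frequency, after splitting
  \<open>\<rho>\<^sup>|\<^sup>m\<^sup>| = \<theta>\<^sup>|\<^sup>m\<^sup>| (\<rho>/\<theta>)\<^sup>|\<^sup>m\<^sup>|\<close>.\<close>

lemma row_sum_le:
  assumes f: "f \<in> hyp_space0 \<theta>" and F: "finite F"
  shows "(\<Sum>m\<in>F. cmod (f m * A m k)) * \<theta> ^ nat \<bar>k\<bar>
           \<le> hyp_norm \<theta> f * geom_l2 (\<rho>/\<theta>) * (\<theta>/r) ^ nat \<bar>k\<bar>"
proof -
  let ?F = "F - {0}" and ?W = "\<lambda>m. cmod (f m) * \<theta> ^ nat \<bar>m\<bar>"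
  have f': "f \<in> hyp_space \<theta>" "f 0 = 0" using f by (auto simp: hyp_space0_def)
  have "(\<Sum>m\<in>F. cmod (f m * A m k)) = (\<Sum>m\<in>?F. cmod (f m * A m k))"
    using F f' by (intro sum.mono_neutral_right) auto
  also have "\<dots> \<le> (\<Sum>m\<in>?F. \<bar>?W m\<bar> * \<bar>(\<rho>/\<theta>) ^ nat \<bar>m\<bar>\<bar> / r ^ nat \<bar>k\<bar>)"
  proof (rule sum_mono)
    fix m assume "m \<in> ?F"
    then have "cmod (f m * A m k) \<le> cmod (f m) * (\<rho> ^ nat \<bar>m\<bar> / r ^ nat \<bar>k\<bar>)"
      unfolding norm_mult by (intro mult_left_mono decay) auto
    then show "cmod (f m * A m k) \<le> \<bar>?W m\<bar> * \<bar>(\<rho>/\<theta>) ^ nat \<bar>m\<bar>\<bar> / r ^ nat \<bar>k\<bar>"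
      using \<theta> \<rho> by (simp add: power_divide abs_mult)
  qed
  also have "\<dots> = (\<Sum>m\<in>?F. \<bar>?W m\<bar> * \<bar>(\<rho>/\<theta>) ^ nat \<bar>m\<bar>\<bar>) / r ^ nat \<bar>k\<bar>"
    by (simp add: sum_divide_distrib)
  also have "\<dots> \<le> (L2_set ?W ?F * L2_set (\<lambda>m. (\<rho>/\<theta>) ^ nat \<bar>m\<bar>) ?F) / r ^ nat \<bar>k\<bar>"
    using r \<theta> by (intro divide_right_mono L2_set_mult_ineq) auto
  also have "\<dots> \<le> (hyp_norm \<theta> f * geom_l2 (\<rho>/\<theta>)) / r ^ nat \<bar>k\<bar>"
    using r \<theta> \<rho> F
    by (intro divide_right_mono mult_mono L2_set_le_hyp_norm f' L2_set_geometric_le hyp_norm_nonneg) auto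
  finally have "(\<Sum>m\<in>F. cmod (f m * A m k)) * \<theta> ^ nat \<bar>k\<bar>
      \<le> (hyp_norm \<theta> f * geom_l2 (\<rho>/\<theta>)) / r ^ nat \<bar>k\<bar> * \<theta> ^ nat \<bar>k\<bar>"
    using \<theta> by (intro mult_right_mono) auto
  then show ?thesis by (simp add: power_divide)
qed

lemma row_summable:
  assumes "f \<in> hyp_space0 \<theta>"
  shows "(\<lambda>m. cmod (f m * A m k)) summable_on UNIV"
proof (rule nonneg_bdd_above_summable_on)
  let ?B = "hyp_norm \<theta> f * geom_l2 (\<rho>/\<theta>) * (\<theta>/r) ^ nat \<bar>k\<bar> / \<theta> ^ nat \<bar>k\<bar>"
  have "(\<Sum>m\<in>F. cmod (f m * A m k)) \<le> ?B" if "finite F" for F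
    using row_sum_le[OF assms that, of k] \<theta> by (simp add: pos_le_divide_eq)
  then show "bdd_above (sum (\<lambda>m. cmod (f m * A m k)) ` {F. F \<subseteq> UNIV \<and> finite F})"
    by (intro bdd_aboveI2[where M = ?B]) blast
qed simp

lemma matrix_op_coeff_le:
  assumes "f \<in> hyp_space0 \<theta>"
  shows "cmod (matrix_op \<theta> A f k) * \<theta> ^ nat \<bar>k\<bar> \<le> hyp_norm \<theta> f * geom_l2 (\<rho>/\<theta>) * (\<theta>/r) ^ nat \<bar>k\<bar>"
proof -
  let ?B = "hyp_norm \<theta> f * geom_l2 (\<rho>/\<theta>) * (\<theta>/r) ^ nat \<bar>k\<bar> / \<theta> ^ nat \<bar>k\<bar>"
  have "cmod (matrix_op \<theta> A f k) \<le> (\<Sum>\<^sub>\<infinity>m. cmod (f m * A m k))"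
    using row_summable[OF assms, of k] assms by (auto simp: matrix_op_def intro!: norm_infsum_bound)
  also have "\<dots> \<le> ?B"
  proof (rule infsum_le_finite_sums)
    show "(\<Sum>m\<in>F. cmod (f m * A m k)) \<le> ?B" if "finite F" for F
      using row_sum_le[OF assms that, of k] \<theta> by (simp add: pos_le_divide_eq)
  qed (rule row_summable[OF assms])
  finally show ?thesis using \<theta> by (simp add: pos_le_divide_eq)
qed

text \<open>The coefficient bound is geometric in the output frequency, so summing its squares over
  \<open>k \<noteq> 0\<close> gives the second factor \<open>geom_l2 (\<theta>/r)\<close>.\<close>

lemma matrix_op_bounded:
  assumes f: "f \<in> hyp_space0 \<theta>"
  shows "matrix_op \<theta> A f \<in> hyp_space0 \<theta>"
    and "hyp_norm \<theta> (matrix_op \<theta> A f) \<le> geom_l2 (\<rho>/\<theta>) * geom_l2 (\<theta>/r) * hyp_norm \<theta> f"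
proof -
  let ?g = "matrix_op \<theta> A f" and ?B = "hyp_norm \<theta> f * geom_l2 (\<rho>/\<theta>)"
  have B: "0 \<le> ?B" using \<theta> \<rho> by (intro mult_nonneg_nonneg hyp_norm_nonneg geom_l2_nonneg) auto
  have zero: "f m * A m 0 = 0" for m
    using f mean_zero[of m] by (cases "m = 0") (auto simp: hyp_space0_def)
  then have "(\<lambda>m. f m * A m 0) = (\<lambda>m. 0)" by (rule ext)
  then have g0: "?g 0 = 0"
    using f by (simp add: matrix_op_def )
  have "L2_set (\<lambda>k. cmod (?g k) * \<theta> ^ nat \<bar>k\<bar>) F \<le> geom_l2 (\<rho>/\<theta>) * geom_l2 (\<theta>/r) * hyp_norm \<theta> f"
    if F: "finite F" for F
  proof -
    have "L2_set (\<lambda>k. cmod (?g k) * \<theta> ^ nat \<bar>k\<bar>) F = L2_set (\<lambda>k. cmod (?g k) * \<theta> ^ nat \<bar>k\<bar>) (F - {0})"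
      unfolding L2_set_def using F g0 by (intro arg_cong[of _ _ sqrt] sum.mono_neutral_right) auto
    also have "\<dots> \<le> L2_set (\<lambda>k. ?B * (\<theta>/r) ^ nat \<bar>k\<bar>) (F - {0})"
      using matrix_op_coeff_le[OF f] \<theta> by (intro L2_set_mono) auto
    also have "\<dots> = ?B * L2_set (\<lambda>k. (\<theta>/r) ^ nat \<bar>k\<bar>) (F - {0})"
      using B by (rule L2_set_right_distrib[symmetric])
    also have "\<dots> \<le> ?B * geom_l2 (\<theta>/r)"
      using B \<theta> r F by (intro mult_left_mono L2_set_geometric_le) auto
    finally show ?thesis by (simp add: mult_ac)
  qed
  from hyp_space_bound[OF \<theta> this] g0
  show "?g \<in> hyp_space0 \<theta>" "hyp_norm \<theta> ?g \<le> geom_l2 (\<rho>/\<theta>) * geom_l2 (\<theta>/r) * hyp_norm \<theta> f"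
    by (auto simp: hyp_space0_def)
qed

lemma matrix_op_diff:
  assumes "f \<in> hyp_space0 \<theta>" "g \<in> hyp_space0 \<theta>"
  shows "matrix_op \<theta> A (\<lambda>k. f k - g k) = (\<lambda>k. matrix_op \<theta> A f k - matrix_op \<theta> A g k)"
proof
  fix k
  have d: "(\<lambda>k. f k - g k) \<in> hyp_space0 \<theta>"
    using assms hyp_diff[OF \<theta>] by (auto simp: hyp_space0_def)
  have sf: "(\<lambda>m. f m * A m k) summable_on UNIV" and sg: "(\<lambda>m. - (g m * A m k)) summable_on UNIV"
    using row_summable[of _ k] assms by (auto intro: abs_summable_summable)
  have "(\<Sum>\<^sub>\<infinity>m. f m * A m k - g m * A m k) = (\<Sum>\<^sub>\<infinity>m. f m * A m k) - (\<Sum>\<^sub>\<infinity>m. g m * A m k)"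
    using infsum_add[OF sf sg] by (simp add: infsum_uminus)
  then show "matrix_op \<theta> A (\<lambda>k. f k - g k) k = matrix_op \<theta> A f k - matrix_op \<theta> A g k"
    using assms d by (simp add: matrix_op_def left_diff_distrib)
qed

end

section \<open>Recognising the Koopman operator\<close>

lemma hyp_topology0_continuous_iff:
  assumes "0 < \<theta>"
  shows "continuous_map (hyp_topology0 \<theta>) (hyp_topology0 \<theta>) L \<longleftrightarrow>
    L ` hyp_space0 \<theta> \<subseteq> hyp_space0 \<theta> \<and>
    (\<forall>f\<in>hyp_space0 \<theta>. \<forall>\<epsilon>>0. \<exists>\<delta>>0. \<forall>g. g \<in> hyp_space0 \<theta> \<and> hyp_dist \<theta> f g < \<delta> \<longrightarrow> hyp_dist \<theta> (L f) (L g) < \<epsilon>)"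
proof -
  interpret Metric_space "hyp_space \<theta>" "hyp_dist \<theta>" using assms by (rule Metric_space_hyp_space)
  have M: "Metric_space (hyp_space0 \<theta>) (hyp_dist \<theta>)"
    by (rule subspace) (auto simp: hyp_space0_def)
  show ?thesis
    unfolding hyp_topology0_def by (rule Metric_space.metric_continuous_map[OF M M])
qed

text \<open>Erasing the constant coefficient of an approximating trigonometric polynomial does not increase
  its distance to an element without constant term, so density is inherited from the full space.\<close>

lemma closure_trig_polys0:
  assumes "0 < \<theta>"
  shows "hyp_topology0 \<theta> closure_of (trig_polys \<inter> hyp_space0 \<theta>) = hyp_space0 \<theta>"
proof -
  interpret H: Metric_space "hyp_space \<theta>" "hyp_dist \<theta>" using assms by (rule Metric_space_hyp_space)
  interpret Metric_space "hyp_space0 \<theta>" "hyp_dist \<theta>"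
    by (rule H.subspace) (auto simp: hyp_space0_def)
  have "\<exists>q\<in>trig_polys \<inter> hyp_space0 \<theta>. hyp_dist \<theta> f q < e"
    if f: "f \<in> hyp_space0 \<theta>" and e: "e > 0" for f e
  proof -
    have f': "f \<in> hyp_space \<theta>" "f 0 = 0" using f by (auto simp: hyp_space0_def)
    then obtain p where p: "p \<in> trig_polys" "hyp_dist \<theta> f p < e"
      using e closure_trig_polys[OF assms] unfolding H.metric_closure_of H.mball_def by blast
    define q where "q = p(0 := 0)"
    have "{k. q k \<noteq> 0} \<subseteq> {k. p k \<noteq> 0}" by (auto simp: q_def)
    then have q: "q \<in> trig_polys"
      using p(1) finite_subset by (auto simp: trig_polys_def)
    then have q0: "q \<in> hyp_space0 \<theta>" using trig_polys_subset by (auto simp: hyp_space0_def q_def)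
    have pH: "p \<in> hyp_space \<theta>" using p(1) trig_polys_subset by blast
    have "hyp_norm \<theta> (\<lambda>k. f k - q k) \<le> hyp_norm \<theta> (\<lambda>k. f k - p k)"
    proof (rule hyp_space_bound(2)[OF assms])
      fix F :: "int set" assume F: "finite F"
      have "L2_set (\<lambda>k. cmod (f k - q k) * \<theta> ^ nat \<bar>k\<bar>) F \<le> L2_set (\<lambda>k. cmod (f k - p k) * \<theta> ^ nat \<bar>k\<bar>) F"
        using assms f' by (intro L2_set_mono) (auto simp: q_def)
      also have "\<dots> \<le> hyp_norm \<theta> (\<lambda>k. f k - p k)"
        by (rule L2_set_le_hyp_norm[OF assms hyp_diff[OF assms f'(1) pH] F])
      finally show "L2_set (\<lambda>k. cmod (f k - q k) * \<theta> ^ nat \<bar>k\<bar>) F \<le> hyp_norm \<theta> (\<lambda>k. f k - p k)" .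
    qed
    then have "hyp_dist \<theta> f q < e" using p(2) by (simp add: hyp_dist_def)
    then show ?thesis using q q0 by blast
  qed
  then show ?thesis
    unfolding hyp_topology0_def metric_closure_of mball_def by auto
qed

text \<open>Two continuous maps into a Hausdorff space that agree on a dense set are equal; hence any
  candidate with the defining properties is the Koopman operator.\<close>

lemma koopman_eqI:
  assumes \<theta>: "0 < \<theta>" and ext: "L \<in> extensional (hyp_space0 \<theta>)"
    and cont: "continuous_map (hyp_topology0 \<theta>) (hyp_topology0 \<theta>) L"
    and trig: "\<And>p. p \<in> trig_polys \<inter> hyp_space0 \<theta> \<Longrightarrow> L p = fourier_coeff (trig_eval p \<circ> T)"
  shows "koopman \<theta> T = L"
  unfolding koopman_def
proof (rule the_equality)
  interpret H: Metric_space "hyp_space \<theta>" "hyp_dist \<theta>" using \<theta> by (rule Metric_space_hyp_space)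
  interpret Metric_space "hyp_space0 \<theta>" "hyp_dist \<theta>"
    by (rule H.subspace) (auto simp: hyp_space0_def)
  have Hd: "Hausdorff_space (hyp_topology0 \<theta>)"
    unfolding hyp_topology0_def by (rule Hausdorff_space_mtopology)
  fix K
  assume K: "K \<in> extensional (hyp_space0 \<theta>) \<and>
      continuous_map (hyp_topology0 \<theta>) (hyp_topology0 \<theta>) K \<and>
      (\<forall>p\<in>trig_polys \<inter> hyp_space0 \<theta>. K p = fourier_coeff (trig_eval p \<circ> T))"
  show "K = L"
  proof (rule extensionalityI[where A = "hyp_space0 \<theta>"])
    fix f assume "f \<in> hyp_space0 \<theta>"
    then have "f \<in> hyp_topology0 \<theta> closure_of (trig_polys \<inter> hyp_space0 \<theta>)"
      using closure_trig_polys0[OF \<theta>] by simp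
    then show "K f = L f"
      by (rule forall_in_closure_of_eq[OF _ Hd]) (use K cont trig in auto)
  qed (use K ext in auto)
qed (use ext cont trig in auto)

lemma hyp_opnorm0_le:
  assumes "0 \<le> M"
    and "\<And>f. f \<in> hyp_space0 \<theta> \<Longrightarrow> L f \<in> hyp_space0 \<theta> \<and> hyp_norm \<theta> (L f) \<le> M * hyp_norm \<theta> f"
  shows "hyp_opnorm0 \<theta> L \<le> ennreal M"
  unfolding hyp_opnorm0_def using assms by (intro Inf_lower) auto

lemma (in decaying_matrix) continuous_matrix_op:
  "continuous_map (hyp_topology0 \<theta>) (hyp_topology0 \<theta>) (matrix_op \<theta> A)"
  unfolding hyp_topology0_continuous_iff[OF \<theta>]
proof (intro conjI ballI allI impI)
  show "matrix_op \<theta> A ` hyp_space0 \<theta> \<subseteq> hyp_space0 \<theta>" using matrix_op_bounded(1) by blast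
  fix f \<epsilon> assume f: "f \<in> hyp_space0 \<theta>" and \<epsilon>: "(\<epsilon>::real) > 0"
  define M where "M = geom_l2 (\<rho>/\<theta>) * geom_l2 (\<theta>/r)"
  have M: "0 \<le> M" unfolding M_def using \<theta> r \<rho> by (intro mult_nonneg_nonneg geom_l2_nonneg) auto
  show "\<exists>\<delta>>0. \<forall>g. g \<in> hyp_space0 \<theta> \<and> hyp_dist \<theta> f g < \<delta> \<longrightarrow>
      hyp_dist \<theta> (matrix_op \<theta> A f) (matrix_op \<theta> A g) < \<epsilon>"
  proof (intro exI conjI allI impI)
    show "\<epsilon> / (M + 1) > 0" using M \<epsilon> by simp
    fix g assume g: "g \<in> hyp_space0 \<theta> \<and> hyp_dist \<theta> f g < \<epsilon> / (M + 1)"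
    have d: "(\<lambda>k. f k - g k) \<in> hyp_space0 \<theta>"
      using f g hyp_diff[OF \<theta>] by (auto simp: hyp_space0_def)
    have "hyp_dist \<theta> (matrix_op \<theta> A f) (matrix_op \<theta> A g) \<le> M * hyp_dist \<theta> f g"
      using matrix_op_bounded(2)[OF d] matrix_op_diff[OF f] g by (simp add: hyp_dist_def M_def)
    also have "\<dots> \<le> (M + 1) * hyp_dist \<theta> f g"
      using hyp_norm_nonneg[OF \<theta>] by (simp add: hyp_dist_def distrib_right)
    also have "\<dots> < \<epsilon>" using g M by (simp add: pos_less_divide_eq mult.commute)
    finally show "hyp_dist \<theta> (matrix_op \<theta> A f) (matrix_op \<theta> A g) < \<epsilon>" .
  qed
qed

lemma (in decaying_matrix) hyp_opnorm0_matrix_op_le: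
  "hyp_opnorm0 \<theta> (matrix_op \<theta> A) \<le> ennreal (geom_l2 (\<rho>/\<theta>) * geom_l2 (\<theta>/r))"
  using \<theta> r \<rho> matrix_op_bounded
  by (intro hyp_opnorm0_le conjI mult_nonneg_nonneg geom_l2_nonneg) auto

lemma hyp_opnorm0_koopman_id_le:
  assumes "0 < \<theta>"
  shows "hyp_opnorm0 \<theta> (koopman \<theta> id) \<le> ennreal 1"
proof -
  let ?I = "restrict id (hyp_space0 \<theta>)"
  have "koopman \<theta> id = ?I"
  proof (rule koopman_eqI[OF assms])
    show "continuous_map (hyp_topology0 \<theta>) (hyp_topology0 \<theta>) ?I"
      unfolding hyp_topology0_continuous_iff[OF assms] by auto
    show "?I p = fourier_coeff (trig_eval p \<circ> id)" if "p \<in> trig_polys \<inter> hyp_space0 \<theta>" for p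
      using that fourier_coeff_trig_eval[of p] by simp
  qed simp
  then show ?thesis using hyp_opnorm0_le[of 1 \<theta> ?I] by simp
qed


section \<open>Fourier coefficients of powers of an inner function\<close>

text \<open>Parametrising the unit circle by \<open>cis\<close> turns \<open>h z dz\<close> into \<open>\<i> h (cis t) cis t dt\<close>.\<close>

lemma fourier_coeff_eq_contour_integral:
  assumes "(h has_contour_integral I) (circlepath 0 1)"
    and "\<And>t. h (cis t) * cis t = g (cis t) * cis (- (of_int k * t))"
  shows "fourier_coeff g k = I / (2 * pi * \<i>)"
proof -
  have "((\<lambda>t. h (cis t) * \<i> * cis t) has_integral I) {0..2*pi}"
    using assms(1) unfolding circlepath_def by (simp add: has_contour_integral_part_circlepath_iff)
  then have "((\<lambda>t. - \<i> * (h (cis t) * \<i> * cis t)) has_integral - \<i> * I) {0..2*pi}"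
    by (rule has_integral_mult_right)
  moreover have "- \<i> * (h (cis t) * \<i> * cis t) = g (cis t) * cis (- (of_int k * t))" for t
    using assms(2)[of t] by (simp add: mult_ac)
  ultimately have "((\<lambda>t. g (cis t) * cis (- (of_int k * t))) has_integral - \<i> * I) {0..2*pi}"
    by simp
  then have "fourier_coeff g k = - \<i> * I / (2 * pi)"
    unfolding fourier_coeff_def by (simp add: integral_unique)
  also have "\<dots> = I / \<i> / (2 * pi)" by simp
  also have "\<dots> = I / (2 * pi * \<i>)" unfolding divide_divide_eq_left by (simp only: mult.commute)
  finally show ?thesis .
qed

lemma fourier_coeff_holomorphic_nonneg:
  assumes "continuous_on (cball 0 1) g" "g holomorphic_on ball 0 1"
  shows "fourier_coeff g (int n) = (deriv ^^ n) g 0 / fact n"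
proof -
  have "((\<lambda>u. g u / (u - 0) ^ Suc n) has_contour_integral (2 * pi * \<i>) / fact n * (deriv ^^ n) g 0)
      (circlepath 0 1)"
    using assms by (intro Cauchy_has_contour_integral_higher_derivative_circlepath) auto
  moreover have "g (cis t) / (cis t - 0) ^ Suc n * cis t = g (cis t) * cis (- (of_int (int n) * t))" for t
  proof -
    have "g (cis t) / (cis t - 0) ^ Suc n * cis t = g (cis t) * inverse (cis t ^ n)"
      by (simp add: field_simps)
    also have "inverse (cis t ^ n) = cis (- (of_int (int n) * t))"
      unfolding Complex.DeMoivre cis_inverse by simp
    finally show ?thesis .
  qed
  ultimately have "fourier_coeff g (int n) = (2 * pi * \<i>) / fact n * (deriv ^^ n) g 0 / (2 * pi * \<i>)"
    by (rule fourier_coeff_eq_contour_integral)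
  then show ?thesis by simp
qed

lemma fourier_coeff_holomorphic_neg:
  assumes "continuous_on (cball 0 1) g" "g holomorphic_on ball 0 1" "k < 0"
  shows "fourier_coeff g k = 0"
proof -
  obtain n where n: "k = - int (Suc n)"
    using assms(3) by (metis negD)
  have "((\<lambda>u. g u * u ^ n) has_contour_integral 0) (circlepath 0 1)"
  proof (rule Cauchy_theorem_disc[of "{}" 0 1])
    show "(\<lambda>u. g u * u ^ n) field_differentiable at z" if "z \<in> ball 0 1 - {}" for z
      using that assms(2)
      by (intro holomorphic_on_imp_differentiable_at[of _ "ball 0 1"] holomorphic_intros) auto
  qed (use assms in \<open>auto intro!: continuous_intros\<close>)
  moreover have "g (cis t) * cis t ^ n * cis t = g (cis t) * cis (- (of_int k * t))" for t
  proof -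
    have "cis t ^ n * cis t = cis t ^ Suc n" by simp
    also have "\<dots> = cis (- (of_int k * t))" unfolding Complex.DeMoivre n of_int_minus of_int_of_nat_eq by (simp only: mult_minus_left minus_minus)
    finally show ?thesis by (simp add: mult.assoc)
  qed
  ultimately show ?thesis using fourier_coeff_eq_contour_integral by fastforce
qed

lemma fourier_coeff_cnj: "fourier_coeff (\<lambda>z. cnj (g z)) k = cnj (fourier_coeff g (- k))"
  unfolding fourier_coeff_def by (simp add: integral_cnj cis_cnj)

lemma fourier_coeff_cong:
  assumes "\<And>z. cmod z = 1 \<Longrightarrow> f z = g z"
  shows "fourier_coeff f = fourier_coeff g"
  unfolding fourier_coeff_def using assms by (intro ext) simp

text \<open>Fourier coefficients live on the unit circle, but for a holomorphic function they are Taylor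
  coefficients, so Cauchy's inequality may be applied on the smaller circle of radius \<open>r\<close>.\<close>

lemma fourier_coeff_holomorphic_le:
  assumes g: "continuous_on (cball 0 1) g" "g holomorphic_on ball 0 1" and "g 0 = 0"
    and r: "0 < r" "r < 1" and B: "\<And>z. cmod z = r \<Longrightarrow> cmod (g z) \<le> B"
  shows "k \<le> 0 \<Longrightarrow> fourier_coeff g k = 0"
    and "cmod (fourier_coeff g k) \<le> B / r ^ nat \<bar>k\<bar>"
proof -
  show zero: "fourier_coeff g k = 0" if "k \<le> 0"
    using that fourier_coeff_holomorphic_neg[OF g] fourier_coeff_holomorphic_nonneg[OF g, of 0] assms(3)
    by (cases "k = 0") auto
  have "cmod (of_real r) = r" using r by simp
  with B[of "of_real r"] norm_ge_zero have B0: "0 \<le> B" using order_trans by blast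
  show "cmod (fourier_coeff g k) \<le> B / r ^ nat \<bar>k\<bar>"
  proof (cases "k \<le> 0")
    case True
    then show ?thesis using zero B0 r by simp
  next
    case False
    have "cmod ((deriv ^^ nat k) g 0) \<le> fact (nat k) * B / r ^ nat k"
    proof (rule Cauchy_inequality)
      show "g holomorphic_on ball 0 r" by (rule holomorphic_on_subset[OF g(2)]) (use r in auto)
      show "continuous_on (cball 0 r) g" by (rule continuous_on_subset[OF g(1)]) (use r in auto)
    qed (use r B in auto)
    then have "cmod ((deriv ^^ nat k) g 0) / fact (nat k) \<le> fact (nat k) * B / r ^ nat k / fact (nat k)"
      by (rule divide_right_mono) simp
    then have "cmod (fourier_coeff g (int (nat k))) \<le> B / r ^ nat k"
      unfolding fourier_coeff_holomorphic_nonneg[OF g] by (simp add: norm_divide)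
    then show ?thesis using False by simp
  qed
qed

text \<open>The properties of a Blaschke product fixing the origin that the estimates rely on.  They are
  stable under composition, so that no formula for \<open>\<tau>(a)\<close> is required.\<close>

definition centred_inner :: "(complex \<Rightarrow> complex) \<Rightarrow> bool" where
  "centred_inner T \<longleftrightarrow> continuous_on (cball 0 1) T \<and> T holomorphic_on ball 0 1 \<and> T 0 = 0 \<and>
     (\<forall>z. cmod z < 1 \<longrightarrow> cmod (T z) < 1) \<and> (\<forall>z. cmod z = 1 \<longrightarrow> cmod (T z) = 1)"

lemma centred_inner_id: "centred_inner id"
  by (simp add: centred_inner_def)

lemma centred_inner_comp:
  assumes "centred_inner S" "centred_inner T"
  shows "centred_inner (S \<circ> T)"
proof -
  have "T ` cball 0 1 \<subseteq> cball 0 1" and "T ` ball 0 1 \<subseteq> ball 0 1"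
    using assms(2) unfolding centred_inner_def by (force simp: le_less)+
  then have "continuous_on (cball 0 1) (S \<circ> T)" "(S \<circ> T) holomorphic_on ball 0 1"
    using assms unfolding centred_inner_def
    by (blast intro: continuous_on_compose holomorphic_on_compose
        continuous_on_subset holomorphic_on_subset)+
  then show ?thesis using assms unfolding centred_inner_def by simp
qed

text \<open>On the unit circle \<open>\<bar>T\<bar> = 1\<close>, so \<open>T\<^sup>-\<^sup>n\<close> is the conjugate of \<open>T\<^sup>n\<close> there and its coefficients are
  those of \<open>T\<^sup>n\<close>, conjugated and reflected.  The mean value vanishes because \<open>T 0 = 0\<close>.\<close>

lemma fourier_coeff_inner_power:
  assumes T: "centred_inner T" and r: "0 < r" "r < 1" and \<rho>: "\<And>z. cmod z \<le> r \<Longrightarrow> cmod (T z) \<le> \<rho>"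
    and m: "m \<noteq> 0"
  shows "cmod (fourier_coeff (\<lambda>z. T z powi m) k) \<le> \<rho> ^ nat \<bar>m\<bar> / r ^ nat \<bar>k\<bar>"
    and "fourier_coeff (\<lambda>z. T z powi m) 0 = 0"
proof -
  define n where "n = nat \<bar>m\<bar>"
  let ?g = "\<lambda>z. T z ^ n"
  have n: "n > 0" using m by (simp add: n_def)
  have g: "continuous_on (cball 0 1) ?g" "?g holomorphic_on ball 0 1" "?g 0 = 0"
    using T n by (auto simp: centred_inner_def intro!: continuous_intros holomorphic_intros)
  have "cmod (?g z) \<le> \<rho> ^ n" if "cmod z = r" for z
    using \<rho>[of z] that by (simp add: norm_power power_mono)
  note bound = fourier_coeff_holomorphic_le[OF g r this]
  have eq: "fourier_coeff (\<lambda>z. T z powi m) k =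
      (if m > 0 then fourier_coeff ?g k else cnj (fourier_coeff ?g (- k)))" for k
  proof (cases "m > 0")
    case True
    then have "(\<lambda>z. T z powi m) = ?g" by (auto simp: n_def power_int_def)
    then show ?thesis using True by simp
  next
    case False
    have "T z powi m = cnj (?g z)" if "cmod z = 1" for z
    proof -
      have "cmod (T z) = 1" using T that by (simp add: centred_inner_def)
      then have "inverse (T z) = cnj (T z)"
        using divide_conv_cnj[of "T z" 1] by (simp add: inverse_eq_divide)
      then show ?thesis using False m by (simp add: power_int_def n_def power_inverse)
    qed
    then have "fourier_coeff (\<lambda>z. T z powi m) = fourier_coeff (\<lambda>z. cnj (?g z))"
      by (rule fourier_coeff_cong)
    then show ?thesis using False by (simp only: fourier_coeff_cnj if_False)
  qed
  show "cmod (fourier_coeff (\<lambda>z. T z powi m) k) \<le> \<rho> ^ nat \<bar>m\<bar> / r ^ nat \<bar>k\<bar>"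
    unfolding eq n_def[symmetric] using bound(2)[of k] bound(2)[of "-k"] by simp
  show "fourier_coeff (\<lambda>z. T z powi m) 0 = 0"
    using bound(1)[of 0] by (simp add: eq)
qed

lemma fourier_coeff_trig_eval_comp:
  assumes T: "centred_inner T" and p: "p \<in> trig_polys"
  shows "fourier_coeff (trig_eval p \<circ> T) k = (\<Sum>m | p m \<noteq> 0. p m * fourier_coeff (\<lambda>z. T z powi m) k)"
proof -
  let ?S = "{m. p m \<noteq> 0}" and ?f = "\<lambda>m t. T (cis t) powi m * cis (- (of_int k * t))"
  have fin: "finite ?S" using p by (simp add: trig_polys_def)
  have "?f m integrable_on {0..2*pi}" for m
  proof (rule integrable_continuous_real)
    have "continuous_on {0..2*pi} (\<lambda>t. T (cis t))"
      by (rule continuous_on_compose2[of "cball 0 1"])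
        (use T in \<open>auto simp: centred_inner_def intro!: continuous_intros\<close>)
    moreover have "T (cis t) \<noteq> 0" for t
      using T unfolding centred_inner_def by (metis norm_cis norm_zero zero_neq_one)
    ultimately show "continuous_on {0..2*pi} (?f m)" by (intro continuous_intros) auto
  qed
  then have "((\<lambda>t. \<Sum>m\<in>?S. p m * ?f m t) has_integral (\<Sum>m\<in>?S. p m * integral {0..2*pi} (?f m))) {0..2*pi}"
    by (intro has_integral_sum fin has_integral_mult_right integrable_integral)
  then have "integral {0..2*pi} (\<lambda>t. \<Sum>m\<in>?S. p m * ?f m t) = (\<Sum>m\<in>?S. p m * integral {0..2*pi} (?f m))"
    by (rule integral_unique)
  then show ?thesis
    by (simp add: fourier_coeff_def trig_eval_def sum_distrib_right mult.assoc sum_divide_distrib)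
qed

text \<open>The operator with matrix entries \<open>fourier_coeff (\<lambda>z. T z powi m) k\<close> is continuous and agrees with
  composition on trigonometric polynomials, so it is the Koopman operator of \<open>T\<close> and inherits the
  bound for decaying matrices.\<close>

lemma hyp_opnorm0_koopman_le:
  assumes "0 < \<theta>" "\<theta> < r" "r < 1" "0 \<le> \<rho>" "\<rho> < \<theta>"
    and T: "centred_inner T" and \<rho>: "\<And>z. cmod z \<le> r \<Longrightarrow> cmod (T z) \<le> \<rho>"
  shows "hyp_opnorm0 \<theta> (koopman \<theta> T) \<le> ennreal (geom_l2 (\<rho>/\<theta>) * geom_l2 (\<theta>/r))"
proof -
  define A where "A m k = fourier_coeff (\<lambda>z. T z powi m) k" for m k
  have r: "0 < r" using assms by simp
  interpret decaying_matrix \<theta> r \<rho> A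
    using assms fourier_coeff_inner_power[OF T r _ \<rho>] by unfold_locales (auto simp: A_def)
  have "koopman \<theta> T = matrix_op \<theta> A"
  proof (rule koopman_eqI[OF \<open>0 < \<theta>\<close> _ continuous_matrix_op])
    show "matrix_op \<theta> A \<in> extensional (hyp_space0 \<theta>)" by (simp add: matrix_op_def)
    fix p assume p: "p \<in> trig_polys \<inter> hyp_space0 \<theta>"
    show "matrix_op \<theta> A p = fourier_coeff (trig_eval p \<circ> T)"
    proof
      fix k
      have "matrix_op \<theta> A p k = (\<Sum>\<^sub>\<infinity>m\<in>{m. p m \<noteq> 0}. p m * A m k)"
        using p by (auto simp: matrix_op_def intro!: infsum_cong_neutral)
      also have "\<dots> = (\<Sum>m | p m \<noteq> 0. p m * A m k)"
        using p by (simp add: trig_polys_def)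
      finally show "matrix_op \<theta> A p k = fourier_coeff (trig_eval p \<circ> T) k"
        using p by (simp add: fourier_coeff_trig_eval_comp[OF T] A_def)
    qed
  qed
  then show ?thesis using hyp_opnorm0_matrix_op_le by simp
qed

section \<open>Inner functions near the fixed point\<close>

text \<open>The two norm claims follow from
  \<open>\<bar>1 - \<lambda>\<^sup>* z\<bar>\<^sup>2 - \<bar>z - \<lambda>\<bar>\<^sup>2 = (1 - \<bar>z\<bar>\<^sup>2) (1 - \<bar>\<lambda>\<bar>\<^sup>2)\<close>,
  with \<open>\<lambda>\<^sup>*\<close> the conjugate of \<open>\<lambda>\<close>.\<close>

lemma blaschke_factor_norm:
  assumes "cmod l < 1"
  shows "cmod z < 1 \<Longrightarrow> cmod ((z - l) / (1 - cnj l * z)) < 1"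
    and "cmod z = 1 \<Longrightarrow> cmod ((z - l) / (1 - cnj l * z)) = 1"
    and "cmod z \<le> 1 \<Longrightarrow> 1 - cnj l * z \<noteq> 0"
proof -
  show nz: "1 - cnj l * z \<noteq> 0" if "cmod z \<le> 1"
  proof
    assume "1 - cnj l * z = 0"
    then have "cmod (cnj l * z) = 1" by (metis eq_iff_diff_eq_0 norm_one)
    moreover have "cmod (cnj l * z) \<le> cmod l * 1"
      unfolding norm_mult complex_mod_cnj using that by (intro mult_left_mono) auto
    ultimately show False using assms by simp
  qed
  have identity: "(cmod (1 - cnj l * z))\<^sup>2 - (cmod (z - l))\<^sup>2 = (1 - (cmod z)\<^sup>2) * (1 - (cmod l)\<^sup>2)"
    unfolding cmod_power2 by (simp add: power2_eq_square algebra_simps)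
  show "cmod ((z - l) / (1 - cnj l * z)) < 1" if z: "cmod z < 1"
  proof -
    have "0 < (1 - (cmod z)\<^sup>2) * (1 - (cmod l)\<^sup>2)"
      using z assms by (intro mult_pos_pos) (simp_all add: abs_square_less_1)
    then have "(cmod (z - l))\<^sup>2 < (cmod (1 - cnj l * z))\<^sup>2" using identity by linarith
    then have "cmod (z - l) < cmod (1 - cnj l * z)" by (rule power_less_imp_less_base) simp
    then show ?thesis using nz z by (simp add: norm_divide divide_less_eq)
  qed
  show "cmod ((z - l) / (1 - cnj l * z)) = 1" if z: "cmod z = 1"
  proof -
    have "(cmod (z - l))\<^sup>2 = (cmod (1 - cnj l * z))\<^sup>2" using identity z by simp
    then have "cmod (z - l) = cmod (1 - cnj l * z)" by (rule power2_eq_imp_eq) auto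
    then show ?thesis using nz z by (simp add: norm_divide)
  qed
qed

lemma centred_inner_blaschke:
  assumes "finite_blaschke \<phi>" "\<phi> 0 = 0"
  shows "centred_inner \<phi>"
proof -
  obtain \<psi> :: real and q :: nat and l :: "nat \<Rightarrow> complex" where q: "q \<ge> 1"
    and l: "\<forall>i\<in>{1..q}. cmod (l i) < 1"
    and eq: "\<forall>z. cmod z \<le> 1 \<longrightarrow>
           \<phi> z = exp (\<i> * complex_of_real \<psi>) * (\<Prod>i=1..q. (z - l i) / (1 - cnj (l i) * z))"
    using assms(1) unfolding finite_blaschke_def by blast
  define B where "B z = exp (\<i> * complex_of_real \<psi>) * (\<Prod>i=1..q. (z - l i) / (1 - cnj (l i) * z))" for z
  have eqB: "\<phi> z = B z" if "cmod z \<le> 1" for z using eq that by (simp add: B_def)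
  have normB: "cmod (B z) = (\<Prod>i=1..q. cmod ((z - l i) / (1 - cnj (l i) * z)))" for z
    by (simp add: B_def norm_mult prod_norm)
  have "continuous_on (cball 0 1) B"
    unfolding B_def using l blaschke_factor_norm(3) by (intro continuous_intros) auto
  then have 1: "continuous_on (cball 0 1) \<phi>" by (rule continuous_on_eq) (simp add: eqB)
  have "B holomorphic_on ball 0 1"
    unfolding B_def using l blaschke_factor_norm(3) by (intro holomorphic_intros) auto
  then have 2: "\<phi> holomorphic_on ball 0 1" by (rule holomorphic_transform) (simp add: eqB)
  have 3: "cmod (\<phi> z) < 1" if z: "cmod z < 1" for z
  proof -
    have "(\<Prod>i=1..q. cmod ((z - l i) / (1 - cnj (l i) * z))) < (\<Prod>i=1..q. 1)"
      using q l blaschke_factor_norm(1)[OF _ z]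
      by (intro prod_mono_strict[of 1]) (auto simp: less_imp_le simp del: prod.neutral_const)
    then show ?thesis using z by (simp add: eqB normB)
  qed
  have 4: "cmod (\<phi> z) = 1" if z: "cmod z = 1" for z
    using z l blaschke_factor_norm(2)[OF _ z] by (simp add: eqB normB)
  show ?thesis unfolding centred_inner_def using 1 2 3 4 assms(2) by blast
qed

text \<open>Equality \<open>\<bar>T z\<bar> = \<bar>z\<bar>\<close> at some \<open>z \<noteq> 0\<close> would force \<open>T\<close> to be a rotation, with derivative of
  modulus \<open>1\<close> at the origin; so the quotient \<open>T z / z\<close> stays strictly inside the unit disc.\<close>

lemma centred_inner_quotient:
  assumes T: "centred_inner T" and d: "cmod (deriv T 0) < 1"
  obtains h where "h holomorphic_on ball 0 1" "\<And>z. cmod z < 1 \<Longrightarrow> T z = z * h z" "h 0 = deriv T 0"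
    "\<And>z. cmod z < 1 \<Longrightarrow> cmod (h z) < 1"
proof -
  have T': "T holomorphic_on ball 0 1" "T 0 = 0" "\<And>z. cmod z < 1 \<Longrightarrow> cmod (T z) < 1"
    using T by (auto simp: centred_inner_def)
  obtain h where h: "h holomorphic_on ball 0 1" "\<And>z. cmod z < 1 \<Longrightarrow> T z = z * h z" "deriv T 0 = h 0"
    using Schwarz3[OF T'(1,2)] by metis
  have "cmod (h z) < 1" if z: "cmod z < 1" for z
  proof (cases "z = 0")
    case True
    then show ?thesis using d h by simp
  next
    case False
    have "cmod (T z) \<noteq> cmod z"
    proof
      assume "cmod (T z) = cmod z"
      then obtain \<alpha> where \<alpha>: "\<And>w. cmod w < 1 \<Longrightarrow> T w = \<alpha> * w" "cmod \<alpha> = 1"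
        using Schwarz_Lemma(3)[OF T' z] z False by blast
      have "((\<lambda>w. \<alpha> * w) has_field_derivative \<alpha>) (at 0)" by (auto intro!: derivative_eq_intros)
      then have "(T has_field_derivative \<alpha>) (at 0)"
        by (rule has_field_derivative_transform_within_open[of _ _ _ "ball 0 1"]) (simp_all add: \<alpha>(1))
      then show False using DERIV_imp_deriv \<alpha>(2) d by fastforce
    qed
    with Schwarz_Lemma(1)[OF T' z] have "cmod z * cmod (h z) < cmod z * 1"
      using h(2)[OF z] by (simp add: norm_mult)
    then show ?thesis using False by simp
  qed
  then show ?thesis using that h by metis
qed

text \<open>The modulus of the quotient \<open>T z / z\<close> attains its maximum on the compact disc of radius \<open>s\<close>,
  and this maximum is less than \<open>1\<close>.\<close>

lemma centred_inner_contraction: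
  assumes "centred_inner T" "cmod (deriv T 0) < 1" "0 \<le> s" "s < 1"
  shows "\<exists>c. 0 < c \<and> c < 1 \<and> (\<forall>z. cmod z \<le> s \<longrightarrow> cmod (T z) \<le> c * cmod z)"
proof -
  obtain h where h: "h holomorphic_on ball 0 1" "\<And>z. cmod z < 1 \<Longrightarrow> T z = z * h z"
    "\<And>z. cmod z < 1 \<Longrightarrow> cmod (h z) < 1"
    using centred_inner_quotient[OF assms(1,2)] by metis
  have "continuous_on (cball 0 s) (\<lambda>z. cmod (h z))"
    by (intro continuous_on_norm holomorphic_on_imp_continuous_on holomorphic_on_subset[OF h(1)])
      (use assms(4) in auto)
  then obtain w where w: "w \<in> cball 0 s" "\<And>z. z \<in> cball 0 s \<Longrightarrow> cmod (h z) \<le> cmod (h w)"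
    using continuous_attains_sup[of "cball 0 s" "\<lambda>z. cmod (h z)"] assms by auto
  have hw: "cmod (h w) < 1" using w(1) h(3) assms by auto
  show ?thesis
    \<comment> \<open>The maximum with \<open>1/2\<close> keeps the constant positive when \<open>h\<close> vanishes on the disc.\<close>
  proof (intro exI[of _ "max (cmod (h w)) (1/2)"] conjI allI impI)
    fix z assume z: "cmod z \<le> s"
    then have "cmod (T z) = cmod (h z) * cmod z" using h(2)[of z] assms by (simp add: norm_mult)
    also have "\<dots> \<le> max (cmod (h w)) (1/2) * cmod z"
      using w(2)[of z] z by (intro mult_right_mono) auto
    finally show "cmod (T z) \<le> max (cmod (h w)) (1/2) * cmod z" .
  qed (use hw in auto)
qed

text \<open>Since \<open>deriv T 0 = 0\<close>, the quotient \<open>T z / z\<close> vanishes at the origin and satisfies the hypotheses of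
  the Schwarz lemma itself.\<close>

lemma centred_inner_superattracting:
  assumes "centred_inner T" "deriv T 0 = 0" "cmod z < 1"
  shows "cmod (T z) \<le> (cmod z)\<^sup>2"
proof -
  obtain h where h: "h holomorphic_on ball 0 1" "\<And>z. cmod z < 1 \<Longrightarrow> T z = z * h z" "h 0 = deriv T 0"
    "\<And>z. cmod z < 1 \<Longrightarrow> cmod (h z) < 1"
    using centred_inner_quotient[OF assms(1)] assms(2) by (metis norm_zero zero_less_one)
  have "cmod (h z) \<le> cmod z" using Schwarz_Lemma(1)[OF h(1) _ h(4) assms(3)] h(3) assms(2) by simp
  then show ?thesis using h(2)[OF assms(3)] by (simp add: norm_mult power2_eq_square mult_left_mono)
qed

section \<open>Decay along words\<close>

lemma word_map_Nil: "word_map \<phi> [] = id"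
  and word_map_snoc: "word_map \<phi> (a @ [j]) = \<phi> j \<circ> word_map \<phi> a"
  by (simp_all add: word_map_def)

lemma words_snoc: "a @ [j] \<in> words N \<longleftrightarrow> a \<in> words N \<and> j \<in> {1..N}"
  by (auto simp: words_def)

lemma centred_inner_word_map:
  assumes "\<And>j. j \<in> {1..N} \<Longrightarrow> centred_inner (\<phi> j)" "a \<in> words N"
  shows "centred_inner (word_map \<phi> a)"
  using assms(2)
proof (induction a rule: rev_induct)
  case Nil
  show ?case by (simp only: word_map_Nil centred_inner_id)
next
  case (snoc j a)
  then show ?case unfolding word_map_snoc words_snoc by (intro centred_inner_comp assms(1)) auto
qed

text \<open>The contraction is only known on the disc of radius \<open>s\<close>; the orbit never leaves it because \<open>c < 1\<close>.\<close>

lemma word_map_contraction: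
  assumes c: "0 \<le> c" "c < 1"
    and \<phi>: "\<And>j z. j \<in> {1..N} \<Longrightarrow> cmod z \<le> s \<Longrightarrow> cmod (\<phi> j z) \<le> c * cmod z"
    and a: "a \<in> words N" and z: "cmod z \<le> s"
  shows "cmod (word_map \<phi> a z) \<le> c ^ length a * cmod z"
  using a
proof (induction a rule: rev_induct)
  case Nil
  show ?case by (simp add: word_map_Nil)
next
  case (snoc j a)
  then have j: "j \<in> {1..N}" and IH: "cmod (word_map \<phi> a z) \<le> c ^ length a * cmod z"
    by (auto simp: words_snoc)
  have "c ^ length a * cmod z \<le> 1 * cmod z" using c by (intro mult_right_mono power_le_one) auto
  then have "cmod (word_map \<phi> a z) \<le> s" using IH z by simp
  then have "cmod (\<phi> j (word_map \<phi> a z)) \<le> c * cmod (word_map \<phi> a z)" by (rule \<phi>[OF j])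
  also have "\<dots> \<le> c * (c ^ length a * cmod z)" using c IH by (intro mult_left_mono) auto
  finally show ?case by (simp add: word_map_snoc mult.assoc)
qed

lemma word_map_superattracting:
  assumes \<phi>: "\<And>j z. j \<in> {1..N} \<Longrightarrow> cmod z < 1 \<Longrightarrow> cmod (\<phi> j z) \<le> (cmod z)\<^sup>2"
    and a: "a \<in> words N" and z: "cmod z < 1"
  shows "cmod (word_map \<phi> a z) \<le> cmod z ^ (2 ^ length a)"
  using a
proof (induction a rule: rev_induct)
  case Nil
  show ?case by (simp add: word_map_Nil)
next
  case (snoc j a)
  then have j: "j \<in> {1..N}" and IH: "cmod (word_map \<phi> a z) \<le> cmod z ^ (2 ^ length a)"
    by (auto simp: words_snoc)
  have "cmod z ^ (2 ^ length a) < 1" using z by (simp add: power_less_one_iff)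
  with IH have "cmod (word_map \<phi> a z) < 1" by simp
  then have "cmod (\<phi> j (word_map \<phi> a z)) \<le> (cmod (word_map \<phi> a z))\<^sup>2" by (rule \<phi>[OF j])
  also have "\<dots> \<le> (cmod z ^ (2 ^ length a))\<^sup>2" using IH by (intro power_mono) auto
  also have "\<dots> = cmod z ^ (2 ^ length (a @ [j]))" by (simp add: mult.commute flip: power_mult)
  finally show ?case by (simp add: word_map_snoc)
qed

text \<open>Any bound \<open>\<rho> n\<close> for the image of the disc of radius \<open>r\<close> under words of length \<open>n\<close> is, up to
  a constant, a bound for the operator norm.  The uniform gap \<open>\<rho> n \<le> \<sigma> < \<theta>\<close> keeps the constant independent
  of \<open>n\<close>.  For the empty word \<open>\<rho> 0\<close> cannot be smaller than \<open>r > \<theta>\<close>, so the matrix estimate does not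
  apply, and the trivial bound \<open>1\<close> for the identity is absorbed by \<open>1 / \<rho> 0\<close>.\<close>

lemma hyp_opnorm0_word_le:
  assumes \<theta>: "0 < \<theta>" "\<theta> < r" "r < 1"
    and \<phi>: "\<And>j. j \<in> {1..N} \<Longrightarrow> centred_inner (\<phi> j)"
    and \<rho>: "\<And>n. 0 \<le> \<rho> n" "\<And>n. n \<noteq> 0 \<Longrightarrow> \<rho> n \<le> \<sigma>" "\<sigma> < \<theta>" "0 < \<rho> 0"
    and bound: "\<And>a z. a \<in> words N \<Longrightarrow> cmod z \<le> r \<Longrightarrow> cmod (word_map \<phi> a z) \<le> \<rho> (length a)"
  shows "\<exists>C>0. \<forall>a\<in>words N. hyp_opnorm0 \<theta> (koopman \<theta> (word_map \<phi> a)) \<le> ennreal (C * \<rho> (length a))"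
proof -
  define K where "K = sqrt (2 / (1 - (\<sigma>/\<theta>)\<^sup>2)) * geom_l2 (\<theta>/r) / \<theta>"
  define C where "C = max (1 / \<rho> 0) K"
  have "hyp_opnorm0 \<theta> (koopman \<theta> (word_map \<phi> a)) \<le> ennreal (C * \<rho> (length a))"
    if a: "a \<in> words N" for a
  proof (cases "a = []")
    case True
    have "1 = 1 / \<rho> 0 * \<rho> 0" using \<rho>(4) by simp
    also have "\<dots> \<le> C * \<rho> 0" unfolding C_def using \<rho>(4) by (intro mult_right_mono) auto
    finally show ?thesis
      using hyp_opnorm0_koopman_id_le[OF \<theta>(1)] True
      by (auto simp: word_map_Nil intro: order_trans ennreal_leI)
  next
    case False
    let ?x = "\<rho> (length a)"
    have x: "0 \<le> ?x" "?x \<le> \<sigma>" using \<rho> False by auto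
    have "hyp_opnorm0 \<theta> (koopman \<theta> (word_map \<phi> a)) \<le> ennreal (geom_l2 (?x/\<theta>) * geom_l2 (\<theta>/r))"
      using x \<rho>(3) by (intro hyp_opnorm0_koopman_le \<theta> centred_inner_word_map[OF \<phi> a] bound a) auto
    also have "\<dots> \<le> ennreal (?x/\<theta> * sqrt (2 / (1 - (\<sigma>/\<theta>)\<^sup>2)) * geom_l2 (\<theta>/r))"
      using x \<rho>(3) \<theta> by (intro ennreal_leI mult_right_mono geom_l2_le geom_l2_nonneg divide_right_mono) auto
    also have "?x/\<theta> * sqrt (2 / (1 - (\<sigma>/\<theta>)\<^sup>2)) * geom_l2 (\<theta>/r) = K * ?x"
      by (simp add: K_def)
    also have "ennreal (K * ?x) \<le> ennreal (C * ?x)"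
      unfolding C_def using x by (intro ennreal_leI mult_right_mono) auto
    finally show ?thesis .
  qed
  moreover have "C > 0" unfolding C_def using \<rho>(4) by (simp add: less_max_iff_disj)
  ultimately show ?thesis by blast
qed

theorem theorem3p1:
  fixes \<theta> :: real and N :: nat and \<phi> :: "nat \<Rightarrow> complex \<Rightarrow> complex"
  assumes "0 < \<theta>" and "\<theta> < 1"
    and "\<And>j. j \<in> {1..N} \<Longrightarrow> finite_blaschke (\<phi> j)"
    and "\<And>j. j \<in> {1..N} \<Longrightarrow> \<phi> j 0 = 0"
  shows "((\<forall>j\<in>{1..N}. deriv (\<phi> j) 0 = 0) \<longrightarrow>
            (\<exists>\<beta>>0. \<exists>\<gamma>>0. \<exists>C>0. \<forall>a\<in>words N.
               hyp_opnorm0 \<theta> (koopman \<theta> (word_map \<phi> a))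
                 \<le> ennreal (C * exp (- \<beta> * exp (\<gamma> * real (length a)))))) \<and>
         ((\<forall>j\<in>{1..N}. cmod (deriv (\<phi> j) 0) < 1) \<longrightarrow>
            (\<exists>\<kappa>>0. \<exists>C>0. \<forall>a\<in>words N.
               hyp_opnorm0 \<theta> (koopman \<theta> (word_map \<phi> a))
                 \<le> ennreal (C * exp (- \<kappa> * real (length a)))))"
proof (intro conjI impI)
  have inner: "centred_inner (\<phi> j)" if "j \<in> {1..N}" for j
    using that assms(3,4) by (intro centred_inner_blaschke)
  {
    assume d: "\<forall>j\<in>{1..N}. deriv (\<phi> j) 0 = 0"
    \<comment> \<open>With \<open>\<theta> < r < sqrt \<theta>\<close> a single letter already maps the disc of radius \<open>r\<close> into one of
      radius \<open>r\<^sup>2 < \<theta>\<close>; then \<open>\<beta> = - ln r\<close> and \<open>\<gamma> = ln 2\<close>.\<close>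
    have "\<theta> < sqrt \<theta>"
      using assms(1,2) by (intro real_less_rsqrt) (simp add: power2_eq_square)
    then obtain r where r: "\<theta> < r" "r < sqrt \<theta>" using dense by blast
    have "sqrt \<theta> < 1" using assms(2) by simp
    with r assms(1) have r01: "0 < r" "r < 1" by linarith+
    have r2: "r\<^sup>2 < \<theta>"
      using power_strict_mono[OF r(2), of 2] r01 assms(1) by simp
    have pow: "r ^ (2 ^ n) = exp (- (- ln r) * exp (ln 2 * real n))" for n
    proof -
      have "exp (ln 2 * real n) = 2 ^ n" by (simp add: exp_of_nat2_mult)
      then have "exp (- (- ln r) * exp (ln 2 * real n)) = exp (real (2 ^ n) * ln r)" by (simp add: mult.commute)
      also have "\<dots> = exp (ln r) ^ (2 ^ n)" by (rule exp_of_nat_mult)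
      finally show ?thesis using r01 by simp
    qed
    have "\<exists>C>0. \<forall>a\<in>words N. hyp_opnorm0 \<theta> (koopman \<theta> (word_map \<phi> a)) \<le> ennreal (C * r ^ (2 ^ length a))"
    proof (rule hyp_opnorm0_word_le[OF assms(1) r(1) r01(2) inner, where \<sigma> = "r\<^sup>2"])
      show "r ^ 2 ^ n \<le> r\<^sup>2" if "n \<noteq> 0" for n
        using r01 that power_increasing[of 1 n "2::nat"] by (intro power_decreasing) auto
      show "cmod (word_map \<phi> a z) \<le> r ^ 2 ^ length a" if a: "a \<in> words N" and z: "cmod z \<le> r" for a z
      proof -
        have "cmod (word_map \<phi> a z) \<le> cmod z ^ 2 ^ length a"
          using z r01 d inner
          by (intro word_map_superattracting[OF _ a] centred_inner_superattracting) auto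
        also have "\<dots> \<le> r ^ 2 ^ length a" using z by (intro power_mono) auto
        finally show ?thesis .
      qed
    qed (use r01 r2 in auto)
    then have "\<exists>C>0. \<forall>a\<in>words N. hyp_opnorm0 \<theta> (koopman \<theta> (word_map \<phi> a))
        \<le> ennreal (C * exp (- (- ln r) * exp (ln 2 * real (length a))))"
      by (simp only: pow)
    moreover have "- ln r > 0" "ln 2 > (0::real)" using r01 by simp_all
    ultimately show "\<exists>\<beta>>0. \<exists>\<gamma>>0. \<exists>C>0. \<forall>a\<in>words N. hyp_opnorm0 \<theta> (koopman \<theta> (word_map \<phi> a))
        \<le> ennreal (C * exp (- \<beta> * exp (\<gamma> * real (length a))))" by blast
  }
  {
    assume d: "\<forall>j\<in>{1..N}. cmod (deriv (\<phi> j) 0) < 1"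
    obtain s where s: "\<theta> < s" "s < 1" using dense[OF assms(2)] by blast
    have "\<forall>j\<in>{1..N}. \<exists>c. 0 < c \<and> c < 1 \<and> (\<forall>z. cmod z \<le> s \<longrightarrow> cmod (\<phi> j z) \<le> c * cmod z)"
      using d s assms(1) inner by (intro ballI centred_inner_contraction) auto
    then obtain cc where cc: "\<forall>j\<in>{1..N}. 0 < cc j \<and> cc j < 1 \<and>
        (\<forall>z. cmod z \<le> s \<longrightarrow> cmod (\<phi> j z) \<le> cc j * cmod z)" by metis
    \<comment> \<open>The element \<open>1/2\<close> makes the maximum meaningful and positive also for \<open>N = 0\<close>.\<close>
    define c where "c = Max (insert (1/2) (cc ` {1..N}))"
    have "1/2 \<le> c" unfolding c_def by (intro Max_ge) auto
    then have c0: "0 < c" by simp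
    have c1: "c < 1" unfolding c_def using cc by (subst Max_less_iff) auto
    have c\<phi>: "cmod (\<phi> j z) \<le> c * cmod z" if j: "j \<in> {1..N}" and z: "cmod z \<le> s" for j z
    proof -
      have "cc j \<le> c" unfolding c_def using j by (intro Max_ge) auto
      then have "cc j * cmod z \<le> c * cmod z" by (intro mult_right_mono) auto
      then show ?thesis using cc j z by force
    qed
    \<comment> \<open>\<open>r < \<theta> / c\<close> ensures that a single letter maps the disc of radius \<open>r\<close> into the disc of
      radius \<open>c r < \<theta>\<close>.\<close>
    have "\<theta> < min s (\<theta> / c)" using s c0 c1 assms(1) by (simp add: field_simps)
    then obtain r where r: "\<theta> < r" "r < s" "r < \<theta> / c" using dense by (metis min_less_iff_conj)
    then have r': "0 < r" "r < 1" "c * r < \<theta>" using assms(1) s c0 by (auto simp: field_simps)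
    have "\<exists>C>0. \<forall>a\<in>words N. hyp_opnorm0 \<theta> (koopman \<theta> (word_map \<phi> a)) \<le> ennreal (C * (c ^ length a * r))"
    proof (rule hyp_opnorm0_word_le[OF assms(1) r(1) r'(2) inner, where \<sigma> = "c * r"])
      show "c ^ n * r \<le> c * r" if "n \<noteq> 0" for n
        using c0 c1 r' that power_decreasing[of 1 n c] by (intro mult_right_mono) auto
      show "cmod (word_map \<phi> a z) \<le> c ^ length a * r" if a: "a \<in> words N" and z: "cmod z \<le> r" for a z
      proof -
        have "cmod (word_map \<phi> a z) \<le> c ^ length a * cmod z"
          using c0 c1 z r(2) by (intro word_map_contraction[OF _ _ c\<phi> a]) auto
        also have "\<dots> \<le> c ^ length a * r" using z c0 by (intro mult_left_mono) auto
        finally show ?thesis .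
      qed
    qed (use c0 r' in auto)
    then obtain C where C: "C > 0" "\<forall>a\<in>words N. hyp_opnorm0 \<theta> (koopman \<theta> (word_map \<phi> a))
        \<le> ennreal (C * (c ^ length a * r))" by blast
    have pow: "C * (c ^ n * r) = C * r * exp (- (- ln c) * real n)" for n
      using c0 by (simp add: exp_of_nat2_mult)
    have "\<forall>a\<in>words N. hyp_opnorm0 \<theta> (koopman \<theta> (word_map \<phi> a))
        \<le> ennreal (C * r * exp (- (- ln c) * real (length a)))"
      using C(2) by (simp only: pow)
    moreover have "- ln c > 0" "C * r > 0" using c0 c1 C r' by simp_all
    ultimately show "\<exists>\<kappa>>0. \<exists>C>0. \<forall>a\<in>words N. hyp_opnorm0 \<theta> (koopman \<theta> (word_map \<phi> a))
        \<le> ennreal (C * exp (- \<kappa> * real (length a)))" by blast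
  }
qed

end
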